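(* Let $M\subset G$ be the Cartan model of the symmetric space $G/K$ defined by $\sigma$, let $X\in\mathbb{K}^{n\times n}$ be a nonzero matrix and put $\widehat{X}=X^*+\sigma(X)$. Then the critical set in $M$ of the height function $h_X^M$ is $$\Sigma(h_X^M)=\Sigma\bigl(h^G_{\sigma(\widehat{X})}\bigr)\cap M.$$
   Context: Let $\mathbb{K}$ be one of $\mathbb{R}$, $\mathbb{C}$, $\mathbb{H}$ (quaternions). For a matrix $A\in\mathbb{K}^{n\times n}$, $A^*$ denotes its conjugate transpose. $G$ is the identity component of the compact Lie group $O(n,\mathbb{K})=\{A\in\mathbb{K}^{n\times n}: AA^*=I\}$, i.e. $G=SO(n)$, $U(n)$ or $Sp(n)$. $\mathbb{K}^{n\times n}$ carries the real inner product $\langle Y,Z\rangle=\Re\operatorname{Tr}(Y^*Z)$ (real part of the trace). $\sigma\colon G\to G$ is an involutive automorphism which is the restriction of an involutive automorphism $\sigma\colon\mathbb{K}^{n\times n}\to\mathbb{K}^{n\times n}$ of unital (real) algebras satisfying $\sigma(Y^* )=\sigma(Y)^*$ for all $Y\in\mathbb{K}^{n\times n}$. $K=\{B\in G:\sigma(B)=B\}$ is the fixed point subgroup. The Cartan model of $G/K$ is the submanifold $M=\{B\sigma(B)^{-1}: B\in G\}\subset G$, i.e. the image of $G/K\to G$, $[B]\mapsto B\sigma(B)^{-1}$; it is the connected component of the identity of $N=\{B\in G:\sigma(B)=B^{-1}\}$. For $Z\in\mathbb{K}^{n\times n}$ the height function is $h_Z(Y)=\Re\operatorname{Tr}(ZY)$,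 $Y\in\mathbb{K}^{n\times n}$; $h_Z^G$ and $h_Z^M$ denote its restrictions to $G$ and to $M$, and $\Sigma(f)$ denotes the set of critical points of a smooth function $f$ on its domain manifold. *)

theory Defs
  imports "HOL-Analysis.Analysis"
begin

section \<open>Quaternions\<close>

text \<open>\<open>Quat a b c d\<close> is the quaternion \<open>a + b i + c j + d k\<close>.\<close>

codatatype quat = Quat (qRe: real) (qI: real) (qJ: real) (qK: real)

lemma quat_eq_iff: "x = y \<longleftrightarrow> qRe x = qRe y \<and> qI x = qI y \<and> qJ x = qJ y \<and> qK x = qK y"
  by (auto intro: quat.expand)

instantiation quat :: ab_group_add
begin

primcorec zero_quat where
  "qRe 0 = 0" | "qI 0 = 0" | "qJ 0 = 0" | "qK 0 = 0"

primcorec plus_quat where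
  "qRe (x + y) = qRe x + qRe y"
| "qI (x + y) = qI x + qI y"
| "qJ (x + y) = qJ x + qJ y"
| "qK (x + y) = qK x + qK y"

primcorec uminus_quat where
  "qRe (- x) = - qRe x" | "qI (- x) = - qI x" | "qJ (- x) = - qJ x" | "qK (- x) = - qK x"

primcorec minus_quat where
  "qRe (x - y) = qRe x - qRe y"
| "qI (x - y) = qI x - qI y"
| "qJ (x - y) = qJ x - qJ y"
| "qK (x - y) = qK x - qK y"

instance
  by standard (simp_all add: quat_eq_iff)

end

instantiation quat :: real_algebra_1
begin

primcorec scaleR_quat where
  "qRe (scaleR r x) = r * qRe x"
| "qI (scaleR r x) = r * qI x"
| "qJ (scaleR r x) = r * qJ x"
| "qK (scaleR r x) = r * qK x"

primcorec one_quat where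
  "qRe 1 = 1" | "qI 1 = 0" | "qJ 1 = 0" | "qK 1 = 0"

primcorec times_quat where
  "qRe (x * y) = qRe x * qRe y - qI x * qI y - qJ x * qJ y - qK x * qK y"
| "qI (x * y) = qRe x * qI y + qI x * qRe y + qJ x * qK y - qK x * qJ y"
| "qJ (x * y) = qRe x * qJ y - qI x * qK y + qJ x * qRe y + qK x * qI y"
| "qK (x * y) = qRe x * qK y + qI x * qJ y - qJ x * qI y + qK x * qRe y"

instance
  by standard (auto simp: quat_eq_iff algebra_simps)

end

instantiation quat :: inverse
begin

definition inverse_quat :: "quat \<Rightarrow> quat" where
  "inverse_quat x = scaleR (inverse ((qRe x)\<^sup>2 + (qI x)\<^sup>2 + (qJ x)\<^sup>2 + (qK x)\<^sup>2))
                      (Quat (qRe x) (- qI x) (- qJ x) (- qK x))"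

definition "x div y = x * inverse y" for x y :: quat

instance ..

end

instance quat :: real_div_algebra
proof
  fix x y :: quat
  let ?N = "(qRe x)\<^sup>2 + (qI x)\<^sup>2 + (qJ x)\<^sup>2 + (qK x)\<^sup>2"
  show "inverse (0::quat) = 0"
    by (simp add: inverse_quat_def quat_eq_iff)
  show "x / y = x * inverse y"
    by (simp add: divide_quat_def)
  assume "x \<noteq> 0"
  then have N: "?N \<noteq> 0"
    by (auto simp: quat_eq_iff add_nonneg_eq_0_iff)
  define s where "s = inverse ?N"
  have 1: "s * ?N = 1" using N by (simp add: s_def)
  have sx: "inverse x = scaleR s (Quat (qRe x) (- qI x) (- qJ x) (- qK x))"
    by (simp add: inverse_quat_def s_def)
  show "inverse x * x = 1" "x * inverse x = 1"
    unfolding sx using 1 by (simp_all add: quat_eq_iff algebra_simps power2_eq_square)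
qed

instantiation quat :: real_inner
begin

definition inner_quat :: "quat \<Rightarrow> quat \<Rightarrow> real" where
  "inner_quat x y = qRe x * qRe y + qI x * qI y + qJ x * qJ y + qK x * qK y"

definition norm_quat :: "quat \<Rightarrow> real" where
  "norm_quat x = sqrt ((qRe x)\<^sup>2 + (qI x)\<^sup>2 + (qJ x)\<^sup>2 + (qK x)\<^sup>2)"

definition sgn_quat :: "quat \<Rightarrow> quat" where
  "sgn_quat x = x /\<^sub>R norm x"

definition dist_quat :: "quat \<Rightarrow> quat \<Rightarrow> real" where
  "dist_quat x y = norm (x - y)"

definition uniformity_quat_def [code del]:
  "(uniformity :: (quat \<times> quat) filter) = (INF e\<in>{0 <..}. principal {(x, y). dist x y < e})"

definition open_quat_def [code del]:
  "open (U :: quat set) \<longleftrightarrow> (\<forall>x\<in>U. eventually (\<lambda>(x', y). x' = x \<longrightarrow> y \<in> U) uniformity)"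

instance
proof
  fix x y z :: quat and r :: real and U :: "quat set"
  show "dist x y = norm (x - y)" by (simp add: dist_quat_def)
  show "sgn x = x /\<^sub>R norm x" by (simp add: sgn_quat_def)
  show "(uniformity :: (quat \<times> quat) filter) = (INF e\<in>{0 <..}. principal {(x, y). dist x y < e})"
    by (simp add: uniformity_quat_def)
  show "open U \<longleftrightarrow> (\<forall>x\<in>U. eventually (\<lambda>(x', y). x' = x \<longrightarrow> y \<in> U) uniformity)"
    by (simp add: open_quat_def)
  show "inner x y = inner y x" by (simp add: inner_quat_def mult.commute)
  show "inner (x + y) z = inner x z + inner y z" by (simp add: inner_quat_def algebra_simps)
  show "inner (scaleR r x) y = r * inner x y" by (simp add: inner_quat_def algebra_simps)
  show "0 \<le> inner x x" by (simp add: inner_quat_def)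
  show "inner x x = 0 \<longleftrightarrow> x = 0"
    by (auto simp: inner_quat_def quat_eq_iff add_nonneg_eq_0_iff)
  show "norm x = sqrt (inner x x)" by (simp add: norm_quat_def inner_quat_def power2_eq_square)
qed

end

instance quat :: real_normed_div_algebra
proof
  fix x y :: quat
  have "inner (x * y) (x * y) = inner x x * inner y y"
    by (simp add: inner_quat_def algebra_simps)
  then show "norm (x * y) = norm x * norm y"
    by (simp add: norm_eq_sqrt_inner real_sqrt_mult)
qed

instantiation quat :: euclidean_space
begin

definition Basis_quat :: "quat set" where
  "Basis = {Quat 1 0 0 0, Quat 0 1 0 0, Quat 0 0 1 0, Quat 0 0 0 1}"

instance
proof
  fix u v x :: quat
  show "(Basis :: quat set) \<noteq> {}" "finite (Basis :: quat set)"
    by (simp_all add: Basis_quat_def)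
  show "inner u v = (if u = v then 1 else 0)" if "u \<in> Basis" "v \<in> Basis"
    using that unfolding Basis_quat_def by (elim insertE emptyE) (simp_all add: inner_quat_def)
  show "(\<forall>u\<in>Basis. inner x u = 0) \<longleftrightarrow> x = 0"
    by (simp add: Basis_quat_def inner_quat_def quat_eq_iff [of x 0])
qed

end


section \<open>The scalars\<close>

text \<open>
  A common interface to the reals, the complex numbers and the quaternions with their
  standard conjugation and real part. The axioms are only a convenience for uniform
  reasoning; the three instances are the ones of interest.
\<close>

class conj_div_algebra = real_normed_div_algebra + euclidean_space +
  fixes conj :: "'a \<Rightarrow> 'a"
    and re :: "'a \<Rightarrow> real"
  assumes conj_add: "conj (x + y) = conj x + conj y"
    and conj_mult: "conj (x * y) = conj y * conj x"
    and conj_conj: "conj (conj x) = x"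
    and add_conj: "x + conj x = (2 * re x) *\<^sub>R 1"
    and inner_eq_re: "inner x y = re (conj x * y)"

instantiation real :: conj_div_algebra
begin
definition conj_real :: "real \<Rightarrow> real" where "conj_real x = x"
definition re_real :: "real \<Rightarrow> real" where "re_real x = x"
instance by standard (simp_all add: conj_real_def re_real_def)
end

instantiation complex :: conj_div_algebra
begin
definition conj_complex :: "complex \<Rightarrow> complex" where "conj_complex z = cnj z"
definition re_complex :: "complex \<Rightarrow> real" where "re_complex z = Re z"
instance
  by standard (simp_all add: conj_complex_def re_complex_def inner_complex_def complex_eq_iff)
end

instantiation quat :: conj_div_algebra
begin
definition conj_quat :: "quat \<Rightarrow> quat" where
  "conj_quat q = Quat (qRe q) (- qI q) (- qJ q) (- qK q)"
definition re_quat :: "quat \<Rightarrow> real" where "re_quat q = qRe q"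
instance
  by standard
    (simp_all add: conj_quat_def re_quat_def quat_eq_iff inner_quat_def algebra_simps)
end


section \<open>Groups, involutions and Cartan models\<close>

definition conj_transpose :: "'k::conj_div_algebra^'n^'m \<Rightarrow> 'k^'m^'n" where
  "conj_transpose A = map_matrix conj (transpose A)"

definition O_group :: "('k::conj_div_algebra^'n^'n) set" where
  "O_group = {A. A ** conj_transpose A = mat 1}"

text \<open>The identity component: $SO(n)$, $U(n)$ or $Sp(n)$ according to the scalars.\<close>

definition G_group :: "('k::conj_div_algebra^'n^'n) set" where
  "G_group = connected_component_set O_group (mat 1)"

text \<open>
  The extension to all matrices of an involutive automorphism of the group. Linearity is
  over the reals also for complex and quaternionic matrices. The last clause says that the
  extension restricts to a map of the group to itself; the other clauses then make this
  restriction an involutive group automorphism.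
\<close>

definition involutive_automorphism :: "('k::conj_div_algebra^'n^'n \<Rightarrow> 'k^'n^'n) \<Rightarrow> bool" where
  "involutive_automorphism \<sigma> \<longleftrightarrow>
     linear \<sigma> \<and> \<sigma> (mat 1) = mat 1 \<and> (\<forall>A B. \<sigma> (A ** B) = \<sigma> A ** \<sigma> B) \<and>
     (\<forall>A. \<sigma> (\<sigma> A) = A) \<and>
     (\<forall>A. \<sigma> (conj_transpose A) = conj_transpose (\<sigma> A)) \<and>
     \<sigma> ` G_group \<subseteq> G_group"

definition cartan_model :: "('k::conj_div_algebra^'n^'n \<Rightarrow> 'k^'n^'n) \<Rightarrow> ('k^'n^'n) set" where
  "cartan_model \<sigma> = {B ** matrix_inv (\<sigma> B) | B. B \<in> G_group}"

definition height :: "'k::conj_div_algebra^'n^'n \<Rightarrow> 'k^'n^'n \<Rightarrow> real" where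
  "height Z Y = re (trace (Z ** Y))"


section \<open>Critical points on submanifolds of a Euclidean space\<close>

text \<open>
  For a smooth embedded submanifold \<open>S\<close>, the velocities at time 0 of the smooth curves
  $(-\varepsilon,\varepsilon) \to S$ through \<open>p\<close>. The function \<open>D k\<close> is the \<open>k\<close>-th
  derivative of the curve \<open>D 0\<close>.
\<close>

definition tangent_space :: "'a::real_normed_vector set \<Rightarrow> 'a \<Rightarrow> 'a set" where
  "tangent_space S p = {v. \<exists>\<epsilon>>0. \<exists>D :: nat \<Rightarrow> real \<Rightarrow> 'a.
      (\<forall>k. \<forall>t\<in>{-\<epsilon><..<\<epsilon>}. (D k has_vector_derivative D (Suc k) t) (at t)) \<and>
      (\<forall>t\<in>{-\<epsilon><..<\<epsilon>}. D 0 t \<in> S) \<and> D 0 0 = p \<and> D 1 0 = v}"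

text \<open>
  The critical points of the restriction of \<open>f\<close> to \<open>S\<close>, for \<open>f\<close> differentiable on the
  ambient space: the differential of the restriction at \<open>p\<close> is the ambient differential
  restricted to the tangent space.
\<close>

definition critical_points :: "'a::real_normed_vector set \<Rightarrow> ('a \<Rightarrow> real) \<Rightarrow> 'a set" where
  "critical_points S f =
     {p \<in> S. \<exists>f'. (f has_derivative f') (at p) \<and> (\<forall>v\<in>tangent_space S p. f' v = 0)}"

end

theory Submission
  imports Defs
begin

text \<open>
  Left translation turns the tangent vectors of \<open>G\<close> at \<open>p\<close> into \<open>p ** W\<close> with \<open>W\<close>
  skew-Hermitian, and those of the Cartan model at \<open>p\<close> into \<open>p ** W\<close> with \<open>W\<close> moreover fixed
  by the involution $\tau(W) = -p^* \sigma(W) p$ of the skew-Hermitian matrices, that is, with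
  \<open>W\<close> of the form $V + \tau(V)$. Since \<open>\<sigma>\<close> preserves $\Re\operatorname{Tr}$ and
  $\sigma(p) = p^*$ on the Cartan model, the derivative of $h_X$ along $p(V + \tau(V))$ equals
  the derivative of $h_{\sigma(\widehat{X})}$ along $pV$.
\<close>

section \<open>Conjugation and real part\<close>

lemma conj_one [simp]: "conj (1::'a::conj_div_algebra) = 1"
  by (metis conj_conj conj_mult mult_1_right)

lemma re_eq_inner: "re (x::'a::conj_div_algebra) = 1 \<bullet> x"
  by (simp add: inner_eq_re)

lemma conj_eq: "conj (x::'a::conj_div_algebra) = (2 * re x) *\<^sub>R 1 - x"
  using add_conj[of x] by (metis add_diff_cancel_left')

lemma linear_re: "linear (re :: 'a::conj_div_algebra \<Rightarrow> real)"
  by (rule linearI) (simp_all add: re_eq_inner inner_add_right)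

lemma linear_conj: "linear (conj :: 'a::conj_div_algebra \<Rightarrow> 'a)"
  by (rule linearI)
     (simp_all add: conj_eq linear_add[OF linear_re] linear_cmul[OF linear_re] algebra_simps)

lemma re_one [simp]: "re (1::'a::conj_div_algebra) = 1"
  by (simp add: re_eq_inner flip: power2_norm_eq_inner)

lemma re_conj [simp]: "re (conj x) = re (x::'a::conj_div_algebra)"
  by (simp add: conj_eq[of x] linear_diff[OF linear_re] linear_cmul[OF linear_re])

text \<open>Conjugation is the reflection \<open>2 * re x - x\<close>, so the real part of a product
  is a symmetric expression in the two factors. This stands in for commutativity over the
  quaternions.\<close>

lemma re_mult_eq: "re (x * y) = 2 * re x * re y - x \<bullet> (y::'a::conj_div_algebra)"
proof -
  have "re (x * y) = conj x \<bullet> y"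
    by (simp add: inner_eq_re conj_conj)
  then show ?thesis
    by (simp add: conj_eq inner_diff_left re_eq_inner[of y])
qed

lemma re_mult_commute: "re (x * y) = re (y * (x::'a::conj_div_algebra))"
  by (simp add: re_mult_eq inner_commute)

text \<open>The product equals its own conjugate, so \<open>add_conj\<close> makes it a real
  multiple of 1.\<close>

lemma mult_conj: "x * conj x = (norm x)\<^sup>2 *\<^sub>R (1::'a::conj_div_algebra)"
proof -
  have "2 *\<^sub>R (x * conj x) = (2 * re (x * conj x)) *\<^sub>R 1"
    using add_conj[of "x * conj x"] by (simp add: conj_mult conj_conj scaleR_2)
  then have "x * conj x = re (x * conj x) *\<^sub>R 1"
    by (simp flip: scaleR_scaleR)
  also have "re (x * conj x) = x \<bullet> x"
    by (simp add: inner_eq_re re_mult_commute)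
  finally show ?thesis by (simp add: power2_norm_eq_inner)
qed

section \<open>Matrices\<close>

lemma bounded_bilinear_matrix_mult:
  "bounded_bilinear ((**) :: 'a::conj_div_algebra^'n^'m \<Rightarrow> 'a^'p^'n \<Rightarrow> 'a^'p^'m)"
  unfolding bilinear_conv_bounded_bilinear[symmetric] bilinear_def
  by (auto intro!: linearI simp: vec_eq_iff matrix_matrix_mult_def algebra_simps
        sum.distrib scaleR_sum_right)

interpretation matrix_mult: bounded_bilinear
  "(**) :: 'a::conj_div_algebra^'n^'m \<Rightarrow> 'a^'p^'n \<Rightarrow> 'a^'p^'m"
  by (rule bounded_bilinear_matrix_mult)

lemma conj_transpose_nth [simp]: "conj_transpose A $ i $ j = conj (A $ j $ i)"
  by (simp add: conj_transpose_def map_matrix_def transpose_def)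

lemma conj_transpose_conj_transpose [simp]: "conj_transpose (conj_transpose A) = A"
  by (simp add: vec_eq_iff conj_conj)

lemma conj_transpose_mult:
  "conj_transpose (A ** B) = conj_transpose B ** conj_transpose A"
  by (simp add: vec_eq_iff matrix_matrix_mult_def linear_sum[OF linear_conj] conj_mult)

lemma linear_conj_transpose: "linear conj_transpose"
  by (rule linearI) (simp_all add: vec_eq_iff linear_add[OF linear_conj] linear_cmul[OF linear_conj])

lemma conj_transpose_mat_1 [simp]:
  "conj_transpose (mat 1 :: 'a::conj_div_algebra^'n^'n) = mat 1"
  by (simp add: vec_eq_iff mat_def linear_0[OF linear_conj])

lemma matrix_mult_assoc: "A ** B ** C = A ** (B ** C)"
  by (simp add: matrix_mul_assoc)

text \<open>The argument avoids determinants and so covers noncommutative scalars: left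
  multiplication by a matrix with a left inverse is an injective real-linear map of a
  finite-dimensional space, hence onto, which yields a right inverse.\<close>

lemma unitary_mult_conj_transpose_iff:
  fixes A :: "'a::conj_div_algebra^'n^'n"
  shows "A ** conj_transpose A = mat 1 \<longleftrightarrow> conj_transpose A ** A = mat 1"
proof -
  have left: "Y ** X = mat 1" if "X ** Y = mat 1" for X Y :: "'a^'n^'n"
  proof -
    have lin: "linear ((**) Y)"
      using matrix_mult.bounded_linear_right bounded_linear.linear by blast
    have "inj ((**) Y)"
      by (rule injI) (metis that matrix_mul_assoc matrix_mul_lid)
    then have "surj ((**) Y)"
      using lin linear_injective_imp_surjective by blast
    then obtain Z where "Y ** Z = mat 1"
      by (metis surjD)
    moreover have "Z = X"
      by (metis calculation that matrix_mul_assoc matrix_mul_lid matrix_mul_rid)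
    ultimately show ?thesis by simp
  qed
  show ?thesis using left by blast
qed

lemma linear_height: "linear (height Z)"
  by (rule linearI) (simp_all add: height_def trace_def matrix_mult.add_right
      matrix_mult.scaleR_right sum.distrib linear_add[OF linear_re] linear_cmul[OF linear_re]
      flip: scaleR_sum_right)

text \<open>Over the quaternions the trace itself need not be cyclic. Its real part is, because real
  parts of products of entries commute.\<close>

lemma height_commute:
  fixes A B :: "'a::conj_div_algebra^'n^'n"
  shows "height A B = height B A"
proof -
  have "height A B = (\<Sum>i\<in>UNIV. \<Sum>j\<in>UNIV. re (A$i$j * B$j$i))" for A B :: "'a^'n^'n"
    by (simp add: height_def trace_def matrix_matrix_mult_def linear_sum[OF linear_re])
  then show ?thesis
    by (simp add: re_mult_commute[of "A$_$_"]) (rule sum.swap)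
qed

lemma height_add_left: "height (A + B) C = height A C + height B C"
  by (simp add: height_def trace_def matrix_mult.add_left sum.distrib linear_add[OF linear_re])

lemma height_mult_shift: "height (A ** B) C = height A (B ** C)"
  by (simp add: height_def matrix_mult_assoc)

lemma height_conj_transpose: "height (conj_transpose A) (conj_transpose B) = height A B"
proof -
  have "height (conj_transpose A) (conj_transpose B) = height B A"
    by (simp add: height_def trace_def linear_sum[OF linear_re] flip: conj_transpose_mult)
  then show ?thesis by (simp add: height_commute)
qed

section \<open>The trace of a real-linear endomorphism\<close>

definition linear_trace :: "('a::euclidean_space \<Rightarrow> 'a) \<Rightarrow> real" where
  "linear_trace f = (\<Sum>b\<in>Basis. f b \<bullet> b)"

text \<open>Both sides are the same double sum of products of matrix entries with respect to
  \<open>Basis\<close>. It follows that the trace is invariant under conjugation by a linear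
  involution such as \<open>\<sigma>\<close>.\<close>

lemma linear_trace_comp_commute:
  fixes f g :: "'a::euclidean_space \<Rightarrow> 'a"
  assumes "linear f" "linear g"
  shows "linear_trace (f \<circ> g) = linear_trace (g \<circ> f)"
proof -
  have expand: "linear_trace (f \<circ> g) = (\<Sum>b\<in>Basis. \<Sum>c\<in>Basis. (g b \<bullet> c) * (f c \<bullet> b))"
    if "linear f" for f g :: "'a \<Rightarrow> 'a"
  proof -
    have "f (g b) \<bullet> b = (\<Sum>c\<in>Basis. (g b \<bullet> c) * (f c \<bullet> b))" for b
    proof -
      have "f (g b) = f (\<Sum>c\<in>Basis. (g b \<bullet> c) *\<^sub>R c)"
        by (simp add: euclidean_representation)
      also have "\<dots> = (\<Sum>c\<in>Basis. (g b \<bullet> c) *\<^sub>R f c)"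
        by (simp add: linear_sum[OF that] linear_cmul[OF that])
      finally show ?thesis by (simp add: inner_sum_left)
    qed
    then show ?thesis by (simp add: linear_trace_def)
  qed
  show ?thesis
    unfolding expand[OF assms(1)] expand[OF assms(2)]
    by (subst sum.swap) (simp add: mult.commute)
qed

lemma sum_Basis_vec:
  "(\<Sum>b\<in>(Basis :: ('a::euclidean_space^'n) set). f b) = (\<Sum>i\<in>UNIV. \<Sum>u\<in>Basis. f (axis i u))"
proof -
  have "(\<Sum>b\<in>(Basis :: ('a^'n) set). f b) = (\<Sum>(i, u)\<in>UNIV \<times> Basis. f (axis i u))"
    by (rule sum.reindex_cong[where l = "\<lambda>(i, u). axis i u"])
       (auto simp: Basis_vec_def inj_on_def axis_eq_axis)
  then show ?thesis
    by (simp add: sum.cartesian_product)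
qed

text \<open>The basis matrix with the unit \<open>u\<close> at position \<open>(i, j)\<close>
  contributes the real part of \<open>Y$i$i * u * conj u\<close>, which is
  \<open>re (Y$i$i)\<close>. Every \<open>i\<close> occurs once for each column \<open>j\<close> and
  each scalar unit \<open>u\<close>, whence the factor.\<close>

lemma linear_trace_matrix_mult:
  "linear_trace ((**) (Y :: 'a::conj_div_algebra^'n^'n) :: 'a^'n^'n \<Rightarrow> 'a^'n^'n) = real (DIM('a^'n)) * re (trace Y)"
proof -
  have inner: "(y * u) \<bullet> u = re y" if "u \<in> Basis" for y u :: 'a
  proof -
    have "(y * u) \<bullet> u = re (conj u * (y * u))"
      by (metis inner_commute inner_eq_re)
    also have "\<dots> = re (y * (u * conj u))"
      by (metis re_mult_commute mult.assoc)
    finally show ?thesis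
      using that by (simp add: mult_conj)
  qed
  have entry: "(Y ** axis i (axis j u)) \<bullet> axis i (axis j u) = (Y$i$i * u) \<bullet> u"
    for i j :: 'n and u
  proof -
    have "(Y ** axis i (axis j u)) $ i $ j = (\<Sum>k\<in>UNIV. Y$i$k * axis i (axis j u) $ k $ j)"
      by (simp add: matrix_matrix_mult_def)
    also have "\<dots> = (\<Sum>k\<in>UNIV. if k = i then Y$i$i * u else 0)"
      by (rule sum.cong) (auto simp: axis_def)
    finally have "(Y ** axis i (axis j u)) $ i $ j = Y$i$i * u"
      by simp
    then show ?thesis by (simp add: inner_axis)
  qed
  show ?thesis
    by (simp add: linear_trace_def sum_Basis_vec entry inner trace_def linear_sum[OF linear_re]
        sum_distrib_left mult.assoc)
qed

section \<open>The exponential flow of a linear map\<close>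

text \<open>This is exp(tL)v, the solution of x' = Lx that starts at \<open>v\<close>.\<close>

definition exp_flow :: "('a::euclidean_space \<Rightarrow> 'a) \<Rightarrow> 'a \<Rightarrow> real \<Rightarrow> 'a" where
  "exp_flow L v t = (\<Sum>n. (t ^ n / fact n) *\<^sub>R (L ^^ n) v)"

lemma summable_exp_flow:
  assumes "linear (L :: 'a::euclidean_space \<Rightarrow> 'a)"
  shows "summable (\<lambda>n. (t ^ n / fact n) *\<^sub>R (L ^^ n) v)"
proof -
  obtain K where K: "\<And>x. norm (L x) \<le> K * norm x" "K > 0"
    using linear_bounded_pos[OF assms] by blast
  have pow: "norm ((L ^^ n) v) \<le> K ^ n * norm v" for n
  proof (induction n)
    case (Suc n)
    have "norm ((L ^^ Suc n) v) \<le> K * norm ((L ^^ n) v)"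
      using K(1) by simp
    also have "\<dots> \<le> K * (K ^ n * norm v)"
      using Suc K(2) by simp
    finally show ?case by (simp add: mult.assoc)
  qed simp
  show ?thesis
  proof (rule summable_comparison_test'[where N = 0])
    show "summable (\<lambda>n. inverse (fact n) * (\<bar>t\<bar> * K) ^ n * norm v)"
      by (intro summable_mult2 summable_exp)
    show "norm ((t ^ n / fact n) *\<^sub>R (L ^^ n) v) \<le> inverse (fact n) * (\<bar>t\<bar> * K) ^ n * norm v" for n
      using mult_left_mono[OF pow[of n], of "\<bar>t\<bar> ^ n / fact n"]
      by (simp add: power_abs power_mult_distrib field_simps)
  qed
qed

lemma exp_flow_0 [simp]: "exp_flow L v 0 = v"
  using suminf_finite[of "{0}" "\<lambda>n. (0 ^ n / fact n) *\<^sub>R (L ^^ n) v"]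
  by (simp add: exp_flow_def)

text \<open>A linear map can be applied to the series term by term. The instances of
  \<open>\<phi>\<close> are one-sided multiplications, algebra homomorphisms and
  \<open>conj_transpose\<close>.\<close>

lemma exp_flow_intertwine:
  assumes "linear \<phi>" "linear L" "linear L'" "\<And>n. \<phi> ((L ^^ n) v) = (L' ^^ n) w"
  shows "\<phi> (exp_flow L v t) = exp_flow L' w t"
proof -
  have "bounded_linear \<phi>" using assms(1) by (simp add: linear_conv_bounded_linear)
  then show ?thesis
    unfolding exp_flow_def
    by (simp add: bounded_linear.suminf summable_exp_flow assms linear_cmul)
qed

lemma exp_flow_uminus:
  assumes "linear L"
  shows "exp_flow (\<lambda>x. - L x) v t = exp_flow L v (- t)"
proof -
  have "((\<lambda>x. - L x) ^^ n) v = (- 1) ^ n *\<^sub>R (L ^^ n) v" for n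
    by (induction n) (simp_all add: linear_cmul[OF assms])
  then show ?thesis
    by (simp add: exp_flow_def power_minus[of t] mult.commute)
qed

text \<open>Each coordinate is an everywhere convergent real power series in \<open>t\<close>, which
  may be differentiated term by term.\<close>

lemma has_vector_derivative_exp_flow:
  assumes "linear L"
  shows "(exp_flow L v has_vector_derivative exp_flow L (L v) t) (at t within S)"
proof -
  define c where "c b n = (L ^^ n) v \<bullet> b / fact n" for b n
  have comp: "exp_flow L v t \<bullet> b = (\<Sum>n. c b n * t ^ n)" for t b
    unfolding exp_flow_def c_def
    by (subst bounded_linear.suminf[OF bounded_linear_inner_left summable_exp_flow[OF assms]])
       (simp add: mult.commute)
  have summ: "summable (\<lambda>n. c b n * t ^ n)" for t b
    using bounded_linear.summable[OF bounded_linear_inner_left summable_exp_flow[OF assms], of t v b]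
    by (simp add: c_def mult.commute)
  have diffs: "(\<Sum>n. diffs (c b) n * t ^ n) = exp_flow L (L v) t \<bullet> b" for b
    unfolding exp_flow_def c_def diffs_def
    by (subst bounded_linear.suminf[OF bounded_linear_inner_left summable_exp_flow[OF assms]])
       (simp add: funpow_swap1 mult.commute del: of_nat_Suc)
  have "((\<lambda>t. exp_flow L v t \<bullet> b) has_vector_derivative exp_flow L (L v) t \<bullet> b) (at t within S)" for b
    unfolding comp diffs[symmetric]
    using termdiffs_strong_converges_everywhere[OF summ, of b t]
    by (simp add: has_real_derivative_iff_has_vector_derivative has_vector_derivative_at_within)
  then have "((\<lambda>t. \<Sum>b\<in>Basis. (exp_flow L v t \<bullet> b) *\<^sub>R b) has_vector_derivative
               (\<Sum>b\<in>Basis. (exp_flow L (L v) t \<bullet> b) *\<^sub>R b)) (at t within S)"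
    by (intro has_vector_derivative_sum
        bounded_linear.has_vector_derivative[OF bounded_linear_scaleR_left])
  then show ?thesis by (simp add: euclidean_representation)
qed


section \<open>One-parameter groups of matrices\<close>

lemma linear_matrix_mult_left: "linear ((**) (W :: 'a::conj_div_algebra^'n^'m) :: 'a^'p^'n \<Rightarrow> _)"
  using matrix_mult.bounded_linear_right bounded_linear.linear by blast

lemma linear_matrix_mult_right:
  "linear (\<lambda>Y :: 'a::conj_div_algebra^'n^'m. Y ** (W :: 'a^'p^'n))"
  using matrix_mult.bounded_linear_left bounded_linear.linear by blast

definition mexp :: "'a::conj_div_algebra^'n^'n \<Rightarrow> real \<Rightarrow> 'a^'n^'n" where
  "mexp W = exp_flow ((**) W) (mat 1)"

lemma mexp_0 [simp]: "mexp W 0 = mat 1"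
  by (simp add: mexp_def)

lemma mexp_mult_eq_exp_flow: "mexp W t ** Z = exp_flow ((**) W) Z t"
  unfolding mexp_def
proof (rule exp_flow_intertwine[OF linear_matrix_mult_right linear_matrix_mult_left linear_matrix_mult_left])
  show "((**) W ^^ n) (mat 1) ** Z = ((**) W ^^ n) Z" for n
    by (induction n) (simp_all add: matrix_mult_assoc)
qed

text \<open>Both products are the flow of left multiplication by \<open>W\<close> that starts at
  \<open>W\<close>.\<close>

lemma mexp_commute: "mexp W t ** W = W ** mexp W t"
proof -
  have "W ** mexp W t = exp_flow ((**) W) W t"
    unfolding mexp_def
  proof (rule exp_flow_intertwine[OF linear_matrix_mult_left linear_matrix_mult_left linear_matrix_mult_left])
    show "W ** ((**) W ^^ n) (mat 1) = ((**) W ^^ n) W" for n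
      by (induction n) simp_all
  qed
  then show ?thesis by (simp add: mexp_mult_eq_exp_flow)
qed

lemma has_vector_derivative_mexp:
  "(mexp W has_vector_derivative W ** mexp W t) (at t within S)"
proof -
  have "exp_flow ((**) W) W t = W ** mexp W t"
    using mexp_mult_eq_exp_flow[of W t W] by (simp add: mexp_commute)
  then show ?thesis
    using has_vector_derivative_exp_flow[OF linear_matrix_mult_left, of W "mat 1" t S]
    by (simp add: mexp_def)
qed

lemma mexp_minus:
  fixes W :: "'a::conj_div_algebra^'n^'n"
  shows "mexp (- W) t = mexp W (- t)"
proof -
  have "(**) (- W) = (\<lambda>Y :: 'a^'n^'n. - (W ** Y))"
    by (simp add: fun_eq_iff matrix_mult.minus_left)
  then show ?thesis
    by (simp add: mexp_def exp_flow_uminus[OF linear_matrix_mult_left])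
qed

lemma mexp_add: "mexp W (s + t) = mexp W s ** mexp W t"
proof -
  \<comment> \<open>The product rule gives two terms that cancel because \<open>W\<close> commutes
    with \<open>mexp W (- t)\<close>. The product is therefore constant in \<open>t\<close>, and its
    value at 0 is \<open>mexp W s\<close>.\<close>
  have deriv: "((\<lambda>t. mexp W (- t) ** mexp W (s + t)) has_vector_derivative 0) (at t)" for s t
  proof -
    have "((\<lambda>t. mexp W (- t)) has_vector_derivative - W ** mexp W (- t)) (at t)"
      using has_vector_derivative_mexp[of "- W" t UNIV] by (simp add: mexp_minus[abs_def])
    moreover have "((\<lambda>t. mexp W (s + t)) has_vector_derivative W ** mexp W (s + t)) (at t)"
      using vector_diff_chain_at[of "\<lambda>t. s + t" 1 t "mexp W" "W ** mexp W (s + t)"]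
        has_vector_derivative_mexp[of W "s + t" UNIV]
        has_vector_derivative_add[OF has_vector_derivative_const[of s] has_vector_derivative_id[of "at t"]]
      by (simp add: o_def)
    ultimately have "((\<lambda>t. mexp W (- t) ** mexp W (s + t)) has_vector_derivative
        mexp W (- t) ** (W ** mexp W (s + t)) + (- W ** mexp W (- t)) ** mexp W (s + t)) (at t)"
      by (rule matrix_mult.has_vector_derivative)
    moreover have "mexp W (- t) ** (W ** mexp W (s + t)) = W ** mexp W (- t) ** mexp W (s + t)"
      by (metis mexp_commute matrix_mul_assoc)
    ultimately show ?thesis by (simp add: matrix_mult.minus_left)
  qed
  have const: "mexp W (- t) ** mexp W (s + t) = mexp W s" for s t
  proof -
    obtain c where "\<And>t. mexp W (- t) ** mexp W (s + t) = c"
      using has_vector_derivative_zero_constant[of UNIV, OF convex_UNIV, of "\<lambda>t. mexp W (- t) ** mexp W (s + t)"] deriv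
      by auto
    from this[of t] this[of 0] show ?thesis by simp
  qed
  have inverse: "mexp W s ** mexp W (- s) = mat 1"
    using const[of "- s" 0] by simp
  have "mexp W s ** mexp W t = mexp W s ** (mexp W (- s) ** mexp W (t + s))"
    by (simp add: const)
  also have "\<dots> = mexp W (s + t)"
    by (simp add: matrix_mul_assoc inverse add.commute)
  finally show ?thesis by simp
qed

lemma mexp_hom:
  assumes "linear \<phi>" "\<phi> (mat 1) = mat 1" "\<And>A B. \<phi> (A ** B) = \<phi> A ** \<phi> B"
  shows "\<phi> (mexp W t) = mexp (\<phi> W) t"
  unfolding mexp_def
proof (rule exp_flow_intertwine[OF assms(1) linear_matrix_mult_left linear_matrix_mult_left])
  show "\<phi> (((**) W ^^ n) (mat 1)) = ((**) (\<phi> W) ^^ n) (mat 1)" for n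
    by (induction n) (simp_all add: assms)
qed

lemma conj_transpose_mexp: "conj_transpose (mexp W t) = mexp (conj_transpose W) t"
  unfolding mexp_def
proof (rule exp_flow_intertwine[OF linear_conj_transpose linear_matrix_mult_left linear_matrix_mult_left])
  \<comment> \<open>\<open>conj_transpose\<close> reverses products, so each new factor appears on
    the right and has to be moved to the left.\<close>
  have comm: "((**) V ^^ n) (mat 1) ** V = V ** ((**) V ^^ n) (mat 1)" for V :: "'a^'n^'n" and n
    by (induction n) (simp_all add: matrix_mult_assoc)
  show "conj_transpose (((**) W ^^ n) (mat 1)) = ((**) (conj_transpose W) ^^ n) (mat 1)" for n
    by (induction n) (simp_all add: conj_transpose_mult comm)
qed

section \<open>Tangent spaces and critical points\<close>

text \<open>Along a curve in \<open>S\<close> the composite with \<open>f\<close> is constant, so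
  the chain rule kills the velocity. Equations that hold on \<open>S\<close> thus become linear
  conditions on its tangent vectors.\<close>

lemma tangent_space_kernel:
  assumes f: "(f has_derivative f') (at p)" and const: "\<And>y. y \<in> S \<Longrightarrow> f y = c"
    and v: "v \<in> tangent_space S p"
  shows "f' v = 0"
proof -
  obtain e D where e: "e > 0"
    and D: "\<And>k t. t \<in> {- e<..<e} \<Longrightarrow> (D k has_vector_derivative D (Suc k) t) (at t)"
    and S: "\<And>t. t \<in> {- e<..<e} \<Longrightarrow> D 0 t \<in> S" and p: "D 0 0 = p" "D 1 0 = v"
    using v unfolding tangent_space_def by blast
  have "(D 0 has_derivative (\<lambda>h. h *\<^sub>R v)) (at 0)"
    using D[of 0 0] e p by (simp add: has_vector_derivative_def)
  then have "((\<lambda>t. f (D 0 t)) has_derivative (\<lambda>h. f' (h *\<^sub>R v))) (at 0)"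
    using has_derivative_compose[of "D 0" _ 0 UNIV f f'] f p by simp
  moreover have "((\<lambda>t. f (D 0 t)) has_derivative (\<lambda>h. 0)) (at 0)"
    by (rule has_derivative_transform_within_open[where s = "{- e<..<e}" and f = "\<lambda>_. c"])
       (use e const S in auto)
  ultimately have "(\<lambda>h. f' (h *\<^sub>R v)) = (\<lambda>h. 0)"
    by (rule has_derivative_unique)
  from fun_cong[OF this, of 1] show ?thesis by simp
qed

lemma critical_points_linear:
  fixes f :: "'a::euclidean_space \<Rightarrow> real"
  assumes "linear f"
  shows "critical_points S f = {p \<in> S. \<forall>v\<in>tangent_space S p. f v = 0}"
proof -
  have "(f has_derivative f) (at p)" for p
    using assms by (rule linear_imp_has_derivative)
  then show ?thesis
    unfolding critical_points_def by (blast dest: has_derivative_unique)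
qed

text \<open>The outer factors allow for curves in the Cartan model, which arise with a group element
  on either side of the exponential.\<close>

lemma mexp_mem_tangent_space:
  assumes "\<And>t. B ** mexp W t ** C \<in> S"
  shows "B ** W ** C \<in> tangent_space S (B ** C)"
proof -
  \<comment> \<open>Every differentiation brings down one more left factor \<open>W\<close>, so all
    higher derivatives are explicit.\<close>
  define D where "D k t = B ** ((**) W ^^ k) (mexp W t) ** C" for k t
  have "(D k has_vector_derivative D (Suc k) t) (at t)" for k t
  proof -
    have "linear ((**) W ^^ k)"
    proof (induction k)
      case (Suc k)
      from linear_compose[OF this linear_matrix_mult_left[of W]] show ?case by (simp add: o_def)
    qed (simp add: linear_id[unfolded id_def])
    from linear_compose[OF linear_compose[OF this linear_matrix_mult_left] linear_matrix_mult_right]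
    have "linear (\<lambda>Y. B ** ((**) W ^^ k) Y ** C)"
      by (simp add: o_def)
    then have "bounded_linear (\<lambda>Y. B ** ((**) W ^^ k) Y ** C)"
      by (simp add: linear_conv_bounded_linear)
    from bounded_linear.has_vector_derivative[OF this has_vector_derivative_mexp[of W t UNIV]]
    show ?thesis by (simp add: D_def[abs_def] funpow_swap1)
  qed
  then show ?thesis
    unfolding tangent_space_def
    using assms by (auto simp: D_def intro!: exI[of _ 1] exI[of _ D])
qed

section \<open>The unitary group and its identity component\<close>

lemma O_groupD:
  assumes "A \<in> O_group"
  shows "A ** conj_transpose A = mat 1" "conj_transpose A ** A = mat 1"
  using assms unitary_mult_conj_transpose_iff by (auto simp: O_group_def)

lemma O_group_cancel:
  assumes "A \<in> O_group"
  shows "A ** (conj_transpose A ** Z) = Z" "conj_transpose A ** (A ** Z) = Z"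
  by (simp_all add: matrix_mul_assoc O_groupD[OF assms])

lemma O_group_mult: "A \<in> O_group \<Longrightarrow> B \<in> O_group \<Longrightarrow> A ** B \<in> O_group"
  using O_groupD(1)[of A] by (simp add: O_group_def conj_transpose_mult matrix_mult_assoc O_group_cancel)

lemma O_group_conj_transpose: "A \<in> O_group \<Longrightarrow> conj_transpose A \<in> O_group"
  using O_groupD by (auto simp: O_group_def)

lemma matrix_inv_O_group:
  assumes "A \<in> O_group"
  shows "matrix_inv A = conj_transpose A"
  unfolding matrix_inv_def
proof (rule some_equality)
  show "X = conj_transpose A" if "A ** X = mat 1 \<and> X ** A = mat 1" for X
    using that O_group_cancel(2)[OF assms, of X] by simp
qed (simp add: O_groupD[OF assms])

lemma mexp_mem_O_group:
  assumes "conj_transpose W = - W"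
  shows "mexp W t \<in> O_group"
  using mexp_add[of W t "- t"] by (simp add: O_group_def conj_transpose_mexp assms mexp_minus)

lemma G_group_subset: "G_group \<subseteq> O_group"
  by (simp add: G_group_def connected_component_subset)

text \<open>A connected component absorbs every connected subset that meets it.\<close>

lemma G_groupI:
  assumes "connected T" "T \<subseteq> O_group" "x \<in> T" "x \<in> G_group" "y \<in> T"
  shows "y \<in> G_group"
proof -
  have "T \<subseteq> connected_component_set O_group x"
    using assms(1-3) by (intro connected_component_maximal)
  also have "\<dots> = G_group"
    using assms(4) connected_component_eq unfolding G_group_def by blast
  finally show ?thesis using assms(5) by blast
qed

text \<open>The continuous image of \<open>G_group\<close> under the map sending \<open>Y\<close> to
  \<open>A ** conj_transpose Y\<close> is connected, and it meets \<open>G_group\<close> in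
  \<open>A\<close>, the image of the identity.\<close>

lemma G_group_mult_conj_transpose:
  fixes A B :: "'a::conj_div_algebra^'n^'n"
  assumes "A \<in> G_group" "B \<in> G_group"
  shows "A ** conj_transpose B \<in> G_group"
proof (rule G_groupI)
  have one: "(mat 1 :: 'a^'n^'n) \<in> G_group"
    by (simp add: G_group_def O_group_def)
  have "linear (\<lambda>Y. A ** conj_transpose Y)"
    using linear_compose[OF linear_conj_transpose linear_matrix_mult_left] by (simp add: o_def)
  then show "connected ((\<lambda>Y. A ** conj_transpose Y) ` G_group)"
    by (intro connected_continuous_image linear_continuous_on)
       (simp_all add: linear_conv_bounded_linear G_group_def)
  show "(\<lambda>Y. A ** conj_transpose Y) ` G_group \<subseteq> O_group"
    using G_group_subset assms(1) by (auto intro!: O_group_mult O_group_conj_transpose)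
  show "A \<in> (\<lambda>Y. A ** conj_transpose Y) ` G_group"
    using one by (intro image_eqI[of _ _ "mat 1"]) simp_all
qed (use assms in auto)

lemma G_group_mult_mexp:
  assumes "A \<in> G_group" "conj_transpose W = - W"
  shows "A ** mexp W t \<in> G_group"
proof (rule G_groupI)
  have "continuous_on UNIV (mexp W)"
    by (intro continuous_at_imp_continuous_on ballI
        has_vector_derivative_continuous[OF has_vector_derivative_mexp])
  then have "continuous_on UNIV (\<lambda>t. A ** mexp W t)"
    by (intro matrix_mult.continuous_on continuous_on_const)
  then show "connected (range (\<lambda>t. A ** mexp W t))"
    by (rule connected_continuous_image) simp
  show "range (\<lambda>t. A ** mexp W t) \<subseteq> O_group"
    using assms G_group_subset by (auto intro!: O_group_mult mexp_mem_O_group)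
  show "A \<in> range (\<lambda>t. A ** mexp W t)"
    by (rule image_eqI[of _ _ 0]) simp_all
qed (use assms in auto)

text \<open>Differentiating \<open>conj_transpose Y ** Y = mat 1\<close> shows that
  \<open>conj_transpose p ** v\<close> is skew-Hermitian. Since \<open>S\<close> is any subset of
  \<open>O_group\<close>, this serves both for the group and for the Cartan model.\<close>

lemma tangent_space_unitary:
  assumes "S \<subseteq> O_group" "p \<in> O_group" "v \<in> tangent_space S p"
  obtains W where "conj_transpose W = - W" "v = p ** W"
proof
  have "(conj_transpose has_derivative conj_transpose) (at p)"
    by (rule linear_imp_has_derivative[OF linear_conj_transpose])
  then have "((\<lambda>Y. conj_transpose Y ** Y) has_derivative
          (\<lambda>v. conj_transpose p ** v + conj_transpose v ** p)) (at p)"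
    by (rule matrix_mult.FDERIV[OF _ has_derivative_ident])
  from tangent_space_kernel[OF this _ assms(3), of "mat 1"]
  have "conj_transpose p ** v + conj_transpose v ** p = 0"
    using assms(1) O_groupD by auto
  then show "conj_transpose (conj_transpose p ** v) = - (conj_transpose p ** v)"
    by (simp add: conj_transpose_mult add_eq_0_iff)
  show "v = p ** (conj_transpose p ** v)"
    by (simp add: O_group_cancel assms(2))
qed

lemma tangent_space_G_group:
  assumes "p \<in> G_group"
  shows "tangent_space G_group p = {p ** W | W. conj_transpose W = - W}"
proof (intro equalityI subsetI)
  fix v assume "v \<in> tangent_space G_group p"
  then show "v \<in> {p ** W | W. conj_transpose W = - W}"
    using tangent_space_unitary[OF G_group_subset] assms G_group_subset by blast
next
  fix v assume "v \<in> {p ** W | W. conj_transpose W = - W}"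
  then show "v \<in> tangent_space G_group p"
    using mexp_mem_tangent_space[of p _ "mat 1" G_group] G_group_mult_mexp[OF assms] by auto
qed

section \<open>Cartan models\<close>

locale matrix_involution =
  fixes \<sigma> :: "'a::conj_div_algebra^'n^'n \<Rightarrow> 'a^'n^'n"
  assumes involutive_automorphism: "involutive_automorphism \<sigma>"
begin

lemma linear: "linear \<sigma>"
  and one [simp]: "\<sigma> (mat 1) = mat 1"
  and mult: "\<sigma> (A ** B) = \<sigma> A ** \<sigma> B"
  and involutive [simp]: "\<sigma> (\<sigma> A) = A"
  and conj_transpose: "\<sigma> (conj_transpose A) = conj_transpose (\<sigma> A)"
  and G_group: "A \<in> G_group \<Longrightarrow> \<sigma> A \<in> G_group"
  using involutive_automorphism by (auto simp: involutive_automorphism_def)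

text \<open>The real part of the trace of \<open>Y\<close> is, up to a factor, the trace of the real-linear
  map \<open>(**) Y\<close>, and \<open>\<sigma>\<close> conjugates \<open>(**) Y\<close> into \<open>(**) (\<sigma> Y)\<close>.\<close>

lemma height_image: "height (\<sigma> A) (\<sigma> B) = height A B"
proof -
  have "linear_trace ((**) (\<sigma> Y) :: 'a^'n^'n \<Rightarrow> _) = linear_trace ((**) Y :: 'a^'n^'n \<Rightarrow> _)" for Y
  proof -
    have "(**) (\<sigma> Y) = \<sigma> \<circ> ((**) Y \<circ> \<sigma>)"
      by (auto simp: mult)
    moreover have "linear_trace (\<sigma> \<circ> ((**) Y \<circ> \<sigma>)) = linear_trace (((**) Y \<circ> \<sigma>) \<circ> \<sigma>)"
      by (intro linear_trace_comp_commute linear linear_compose[OF linear linear_matrix_mult_left])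
    moreover have "((**) Y \<circ> \<sigma>) \<circ> \<sigma> = (**) Y"
      by auto
    ultimately show ?thesis by simp
  qed
  from this[of "A ** B"] show ?thesis
    by (simp add: linear_trace_matrix_mult height_def flip: mult)
qed

lemma cartan_model_eq: "cartan_model \<sigma> = (\<lambda>B. B ** conj_transpose (\<sigma> B)) ` G_group"
proof -
  have "matrix_inv (\<sigma> B) = conj_transpose (\<sigma> B)" if "B \<in> G_group" for B
    using G_group[OF that] G_group_subset by (blast intro: matrix_inv_O_group)
  then show ?thesis by (force simp: cartan_model_def)
qed

lemma cartan_model_subset: "cartan_model \<sigma> \<subseteq> G_group"
  by (auto simp: cartan_model_eq intro: G_group_mult_conj_transpose G_group)

lemma cartan_model_image:
  assumes "p \<in> cartan_model \<sigma>"
  shows "\<sigma> p = conj_transpose p"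
  using assms by (auto simp: cartan_model_eq mult conj_transpose conj_transpose_mult)

text \<open>Differentiating the relation \<open>\<sigma> Y = conj_transpose Y\<close>, which holds
  on the model, gives one inclusion. For the other, the curve p exp(tW) is shown to stay in the
  model.\<close>

lemma tangent_space_cartan_model:
  assumes p: "p \<in> cartan_model \<sigma>"
  shows "tangent_space (cartan_model \<sigma>) p =
    {p ** W | W. conj_transpose W = - W \<and> conj_transpose p ** \<sigma> W ** p = - W}"
    (is "_ = ?T")
proof (intro equalityI subsetI)
  have pO: "p \<in> O_group" using p cartan_model_subset G_group_subset by blast
  fix v assume v: "v \<in> tangent_space (cartan_model \<sigma>) p"
  then obtain W where W: "conj_transpose W = - W" "v = p ** W"
    using tangent_space_unitary[OF _ pO v] cartan_model_subset G_group_subset by blast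
  have "linear (\<lambda>Y. \<sigma> Y - conj_transpose Y)"
    by (intro linear_compose_sub linear linear_conj_transpose)
  then have "((\<lambda>Y. \<sigma> Y - conj_transpose Y) has_derivative (\<lambda>Y. \<sigma> Y - conj_transpose Y)) (at p)"
    by (rule linear_imp_has_derivative)
  from tangent_space_kernel[OF this _ v, of 0]
  have "\<sigma> v = conj_transpose v" by (simp add: cartan_model_image)
  then have "conj_transpose p ** \<sigma> W = - W ** conj_transpose p"
    by (simp add: W mult conj_transpose_mult cartan_model_image[OF p])
  then have "conj_transpose p ** \<sigma> W ** p = - W"
    by (simp add: matrix_mult_assoc O_groupD[OF pO])
  with W show "v \<in> ?T" by auto
next
  fix v assume "v \<in> ?T"
  then obtain W where W: "conj_transpose W = - W" "conj_transpose p ** \<sigma> W ** p = - W" "v = p ** W"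
    by auto
  obtain B where B: "B \<in> G_group" "p = B ** conj_transpose (\<sigma> B)"
    using p by (auto simp: cartan_model_eq)
  define C where "C = \<sigma> B"
  have BO: "B \<in> O_group" and CO: "C \<in> O_group"
    using B(1) G_group G_group_subset by (auto simp: C_def)
  \<comment> \<open>With p = B C^* this choice gives p exp(tW) = B exp(tU) C^*, and the condition on
    \<open>W\<close> becomes \<open>\<sigma> U = - U\<close>.\<close>
  define U where "U = conj_transpose C ** W ** C"
  have skew: "conj_transpose U = - U"
    by (simp add: U_def conj_transpose_mult W matrix_mult.minus_left matrix_mult.minus_right matrix_mult_assoc)
  have "U = - (conj_transpose C ** (conj_transpose p ** \<sigma> W ** p) ** C)"
    by (simp add: U_def W matrix_mult.minus_left matrix_mult.minus_right)
  also have "\<dots> = - (conj_transpose B ** \<sigma> W ** B)"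
    by (simp add: B(2) conj_transpose_mult matrix_mult_assoc O_group_cancel[OF CO] O_groupD[OF CO]
        flip: C_def)
  also have "\<dots> = - \<sigma> U"
    by (simp add: U_def mult conj_transpose C_def)
  finally have U: "\<sigma> U = - U" by (metis minus_minus)
  have "B ** mexp U t ** conj_transpose C \<in> cartan_model \<sigma>" for t
  proof -
    have "\<sigma> (mexp U s) = conj_transpose (mexp U s)" for s
      by (simp add: mexp_hom linear mult U conj_transpose_mexp skew)
    \<comment> \<open>The element B exp(tU/2) of the group maps to the wanted point of the model:
      \<open>\<sigma>\<close> and \<open>conj_transpose\<close> cancel on the exponential, so its
      two halves multiply to exp(tU).\<close>
    then have "(B ** mexp U (t / 2)) ** conj_transpose (\<sigma> (B ** mexp U (t / 2)))
        = B ** (mexp U (t / 2) ** mexp U (t / 2)) ** conj_transpose C"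
      by (simp add: mult conj_transpose_mult matrix_mult_assoc C_def)
    then show ?thesis
      unfolding cartan_model_eq
      by (intro image_eqI[OF _ G_group_mult_mexp[OF B(1) skew, of "t / 2"]]) (simp flip: mexp_add)
  qed
  from mexp_mem_tangent_space[OF this]
  have "B ** U ** conj_transpose C \<in> tangent_space (cartan_model \<sigma>) p"
    by (simp add: B(2) C_def)
  also have "B ** U ** conj_transpose C = v"
    by (simp add: U_def W(3) B(2) matrix_mult_assoc O_groupD[OF CO] flip: C_def)
  finally show "v \<in> tangent_space (cartan_model \<sigma>) p" .
qed

text \<open>The invariance \<open>height_image\<close> moves \<open>\<sigma>\<close> from
  \<open>W\<close> to \<open>X\<close>. Conjugate transposition then produces the coefficient
  \<open>conj_transpose (\<sigma> X)\<close> and a sign from the skewness of \<open>W\<close>;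
  together with \<open>X\<close> this coefficient makes up the image of the symmetrized matrix under
  \<open>\<sigma>\<close>.\<close>

lemma height_symmetrized:
  assumes p: "p \<in> cartan_model \<sigma>" and W: "conj_transpose W = - W"
  shows "height X (p ** (W - conj_transpose p ** \<sigma> W ** p))
       = height (\<sigma> (conj_transpose X + \<sigma> X)) (p ** W)"
proof -
  have pO: "p \<in> O_group" using p cartan_model_subset G_group_subset by blast
  have "height X (p ** (conj_transpose p ** \<sigma> W ** p)) = height X (\<sigma> W ** p)"
    by (simp add: matrix_mul_assoc O_groupD[OF pO])
  also have "\<dots> = height (p ** X) (\<sigma> W)"
    by (metis height_commute height_mult_shift)
  also have "\<dots> = height (conj_transpose p ** \<sigma> X) W"
    using height_image[of "p ** X" "\<sigma> W"] by (simp add: mult cartan_model_image[OF p])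
  also have "\<dots> = height (conj_transpose (\<sigma> X) ** p) (- W)"
    using height_conj_transpose[of "conj_transpose p ** \<sigma> X" W] by (simp add: conj_transpose_mult W)
  also have "\<dots> = - height (conj_transpose (\<sigma> X)) (p ** W)"
    by (simp add: height_mult_shift linear_neg[OF linear_height] matrix_mult.minus_right)
  finally show ?thesis
    by (simp add: matrix_mult.diff_right linear_diff[OF linear_height] linear_add[OF linear] conj_transpose
        height_add_left)
qed

theorem critical_points_cartan_model:
  "critical_points (cartan_model \<sigma>) (height X) =
   critical_points G_group (height (\<sigma> (conj_transpose X + \<sigma> X))) \<inter> cartan_model \<sigma>"
proof -
  have "(\<forall>v\<in>tangent_space (cartan_model \<sigma>) p. height X v = 0) \<longleftrightarrow>
        (\<forall>v\<in>tangent_space G_group p. height (\<sigma> (conj_transpose X + \<sigma> X)) v = 0)"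
    if p: "p \<in> cartan_model \<sigma>" for p
  proof -
    have pG: "p \<in> G_group" and pO: "p \<in> O_group"
      using p cartan_model_subset G_group_subset by blast+
    \<comment> \<open>On skew-Hermitian matrices this is, after left translation, the differential
      at \<open>p\<close> of the map sending \<open>Y\<close> to
      \<open>conj_transpose (\<sigma> Y)\<close>, which fixes the Cartan model pointwise.\<close>
    define \<tau> where "\<tau> W = - (conj_transpose p ** \<sigma> W ** p)" for W
    have \<tau>\<tau>: "\<tau> (\<tau> W) = W" for W
      unfolding \<tau>_def linear_neg[OF linear] mult conj_transpose cartan_model_image[OF p]
      by (simp add: matrix_mult.minus_left matrix_mult.minus_right matrix_mul_assoc O_groupD[OF pO])
         (simp add: matrix_mult_assoc O_groupD[OF pO])
    have \<tau>_add: "\<tau> (V + W) = \<tau> V + \<tau> W" for V W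
      by (simp add: \<tau>_def linear_add[OF linear] matrix_mult.add_left matrix_mult.add_right)
    have \<tau>_skew: "conj_transpose (\<tau> W) = - \<tau> W" if "conj_transpose W = - W" for W
      unfolding \<tau>_def linear_neg[OF linear_conj_transpose] conj_transpose_mult conj_transpose[symmetric] that
      by (simp add: linear_neg[OF linear] matrix_mult.minus_left matrix_mult.minus_right matrix_mul_assoc)
    have sym: "height X (p ** (W + \<tau> W)) = height (\<sigma> (conj_transpose X + \<sigma> X)) (p ** W)"
      if "conj_transpose W = - W" for W
      using height_symmetrized[OF p that] by (simp add: \<tau>_def)
    have "A = - W \<longleftrightarrow> - A = W" for A W :: "'a^'n^'n"
      by auto
    then have T: "tangent_space (cartan_model \<sigma>) p = {p ** W | W. conj_transpose W = - W \<and> \<tau> W = W}"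
      unfolding tangent_space_cartan_model[OF p] \<tau>_def by simp
    \<comment> \<open>Since \<open>\<tau>\<close> is an additive involution,
      \<open>W + \<tau> W\<close> is always fixed, and a fixed \<open>W\<close> is half of
      \<open>W + \<tau> W\<close>. Testing on fixed \<open>W\<close> is therefore the same as
      testing on all symmetrized ones.\<close>
    have "(\<forall>v\<in>tangent_space (cartan_model \<sigma>) p. height X v = 0) \<longleftrightarrow>
          (\<forall>W. conj_transpose W = - W \<longrightarrow> height X (p ** (W + \<tau> W)) = 0)"
    proof (intro iffI allI impI ballI)
      fix W :: "'a^'n^'n" assume *: "\<forall>v\<in>tangent_space (cartan_model \<sigma>) p. height X v = 0" and W: "conj_transpose W = - W"
      have "conj_transpose (W + \<tau> W) = - (W + \<tau> W)" "\<tau> (W + \<tau> W) = W + \<tau> W"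
        by (simp_all add: linear_add[OF linear_conj_transpose] W \<tau>_skew \<tau>_add \<tau>\<tau> add.commute)
      then show "height X (p ** (W + \<tau> W)) = 0" using * T by blast
    next
      fix v assume *: "\<forall>W. conj_transpose W = - W \<longrightarrow> height X (p ** (W + \<tau> W)) = 0"
        and "v \<in> tangent_space (cartan_model \<sigma>) p"
      then obtain W where W: "v = p ** W" "conj_transpose W = - W" "\<tau> W = W"
        unfolding T by blast
      then have "2 * height X v = height X (p ** (W + \<tau> W))"
        by (simp add: matrix_mult.add_right linear_add[OF linear_height])
      moreover have "height X (p ** (W + \<tau> W)) = 0"
        using * W by blast
      ultimately show "height X v = 0" by simp
    qed
    also have "\<dots> \<longleftrightarrow> (\<forall>v\<in>tangent_space G_group p. height (\<sigma> (conj_transpose X + \<sigma> X)) v = 0)"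
      unfolding tangent_space_G_group[OF pG] using sym by auto
    finally show ?thesis .
  qed
  then show ?thesis
    unfolding critical_points_linear[OF linear_height] using cartan_model_subset by auto
qed

end

theorem corollary2p7:
  shows "(\<forall>(\<sigma> :: real^'n^'n \<Rightarrow> real^'n^'n) X.
            involutive_automorphism \<sigma> \<longrightarrow> X \<noteq> 0 \<longrightarrow>
            (let Xh = conj_transpose X + \<sigma> X in
             critical_points (cartan_model \<sigma>) (height X) =
             critical_points G_group (height (\<sigma> Xh)) \<inter> cartan_model \<sigma>))
       \<and> (\<forall>(\<sigma> :: complex^'n^'n \<Rightarrow> complex^'n^'n) X.
            involutive_automorphism \<sigma> \<longrightarrow> X \<noteq> 0 \<longrightarrow>
            (let Xh = conj_transpose X + \<sigma> X in
             critical_points (cartan_model \<sigma>) (height X) =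
             critical_points G_group (height (\<sigma> Xh)) \<inter> cartan_model \<sigma>))
       \<and> (\<forall>(\<sigma> :: quat^'n^'n \<Rightarrow> quat^'n^'n) X.
            involutive_automorphism \<sigma> \<longrightarrow> X \<noteq> 0 \<longrightarrow>
            (let Xh = conj_transpose X + \<sigma> X in
             critical_points (cartan_model \<sigma>) (height X) =
             critical_points G_group (height (\<sigma> Xh)) \<inter> cartan_model \<sigma>))"
  unfolding Let_def
  by (intro conjI allI impI matrix_involution.critical_points_cartan_model matrix_involution.intro)

end
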